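(* Let $H$ be a real Hilbert space and let $A: H\rightrightarrows H$ be a maximal monotone operator with $0\in \mathrm{rge}(A)$. Let $S:=A^{-1}(0)$ (a nonempty closed convex set), let $\tilde{x}:=\mathrm{proj}_S(0)$ be its least-norm element, and let $a:=\Vert\tilde{x}\Vert$. Suppose that $A^{-1}$ is truncately $R$-continuous at $0$ with modulus function $\rho$ and associated radius $\sigma>0$, i.e. $\rho:\mathbb{R}^+\to\mathbb{R}^+$ is non-decreasing with $\lim_{r\to0^+}\rho(r)=\rho(0)=0$ and $$A^{-1}(y)\cap a\mathbb{B}\subset A^{-1}(0)+\rho(\Vert y\Vert)\mathbb{B}\quad\text{for all } y\in\sigma\mathbb{B}.$$ For $\varepsilon>0$ let $x_\varepsilon:=(A+\varepsilon\, Id)^{-1}(0)$ be the unique solution of $0\in Ax_\varepsilon+\varepsilon x_\varepsilon$. Then for every $\varepsilon>0$ small enough (namely with $\varepsilon a\le\sigma$) one has $$\Vert x_\varepsilon\Vert\le\Vert\tilde{x}\Vert \quad\text{and}\quad d(x_\varepsilon,S)\le\rho(\varepsilon\Vert\tilde{x}\Vert)=\rho(\varepsilon a).$$ In particular, $\Vert x_\varepsilon\Vert$ increases as $\varepsilon$ decreases, i.e. $\Vert x_\delta\Vert\le\Vert x_\varepsilon\Vert$ whenever $0<\varepsilon<\delta$ are in this range. Furthermore, $\lim_{\varepsilon\to0^+}x_\varepsilon=\tilde{x}$ (in norm), with the rate $$\Vert x_\varepsilon-\tilde{x}\Vert\le\rho(\varepsilon a)+\sqrt{\rho^2(\varepsilon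 a)+2\rho(\varepsilon a)a}$$ for every such $\varepsilon$.
   Context: $\mathbb{B}$ is the closed unit ball of $H$; $Id$ is the identity operator; $\mathbb{R}^+=[0,\infty)$. For a set-valued map $A:H\rightrightarrows H$, $\mathrm{rge}(A)=\bigcup_{x\in H}A(x)$ and $A^{-1}(y)=\{x\in H: y\in A(x)\}$. $A$ is monotone if $\langle x^*-y^*,x-y\rangle\ge0$ for all $x^*\in A(x)$, $y^*\in A(y)$, and maximal monotone if moreover its graph is not strictly contained in the graph of another monotone operator. $d(s,K)=\inf_{x\in K}\Vert s-x\Vert$, and $\mathrm{proj}_K(s)$ is the point of the closed convex set $K$ closest to $s$. *)

theory Defs
  imports "HOL-Analysis.Analysis"
begin

type_synonym 'a svmap = "'a \<Rightarrow> 'a set"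

definition sv_graph :: "'a svmap \<Rightarrow> ('a \<times> 'a) set" where
  "sv_graph A = {(x, y). y \<in> A x}"

definition sv_range :: "'a svmap \<Rightarrow> 'a set" where
  "sv_range A = (\<Union>x. A x)"

definition sv_inverse :: "'a svmap \<Rightarrow> 'a svmap" where
  "sv_inverse A y = {x. y \<in> A x}"

definition monotone_operator :: "'a::real_inner svmap \<Rightarrow> bool" where
  "monotone_operator A \<longleftrightarrow>
     (\<forall>x y. \<forall>x'\<in>A x. \<forall>y'\<in>A y. inner (x' - y') (x - y) \<ge> 0)"

definition maximal_monotone :: "'a::real_inner svmap \<Rightarrow> bool" where
  "maximal_monotone A \<longleftrightarrow>
     monotone_operator A \<and> (\<nexists>B. monotone_operator B \<and> sv_graph A \<subset> sv_graph B)"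

(* The library constant closest_point has the sort constraint heine_borel, hence is only
   available in finite dimension. *)
definition proj :: "'a::real_inner set \<Rightarrow> 'a \<Rightarrow> 'a" where
  "proj K s = (THE x. x \<in> K \<and> (\<forall>y\<in>K. dist s x \<le> dist s y))"

(* A map from [0, \<infinity>) to itself is a real function of which only the values on {0..} matter. *)
definition modulus_function :: "(real \<Rightarrow> real) \<Rightarrow> bool" where
  "modulus_function \<rho> \<longleftrightarrow>
     (\<forall>r\<ge>0. \<rho> r \<ge> 0) \<and> mono_on {0..} \<rho> \<and> (\<rho> \<longlongrightarrow> 0) (at_right 0) \<and> \<rho> 0 = 0"

(* F is truncately R-continuous at 0, with truncation radius a, modulus function \<rho> and
   radius \<sigma>. The sum is the Minkowski sum of sets. *)
definition truncately_R_continuous_at_0 ::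
    "'a::real_inner svmap \<Rightarrow> real \<Rightarrow> (real \<Rightarrow> real) \<Rightarrow> real \<Rightarrow> bool" where
  "truncately_R_continuous_at_0 F a \<rho> \<sigma> \<longleftrightarrow>
     \<sigma> > 0 \<and> modulus_function \<rho> \<and>
     (\<forall>y\<in>cball 0 \<sigma>. F y \<inter> cball 0 a \<subseteq> F 0 + cball 0 (\<rho> (norm y)))"

definition add_scaled_id :: "'a::real_inner svmap \<Rightarrow> real \<Rightarrow> 'a svmap" where
  "add_scaled_id A \<epsilon> x = A x + {\<epsilon> *\<^sub>R x}"

(* The point of the singleton set (A + \<epsilon> Id)^(-1)(0). *)
definition tikhonov_point :: "'a::real_inner svmap \<Rightarrow> real \<Rightarrow> 'a" where
  "tikhonov_point A \<epsilon> = the_elem (sv_inverse (add_scaled_id A \<epsilon>) 0)"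

end

theory Submission
  imports Defs
begin

text \<open>
  The point \<open>x \<epsilon>\<close> satisfies \<open>- \<epsilon> x \<epsilon> \<in> A (x \<epsilon>)\<close>, and all the estimates come from
  monotonicity applied to two such points, or to one such point and the least-norm zero \<open>xt\<close>.
  The pair \<open>(x \<epsilon>, xt)\<close> gives \<open>\<parallel>x \<epsilon>\<parallel>\<^sup>2 \<le> \<langle>x \<epsilon>, xt\<rangle>\<close>, hence \<open>\<parallel>x \<epsilon>\<parallel> \<le> a\<close> and
  \<open>\<parallel>x \<epsilon> - xt\<parallel>\<^sup>2 \<le> a\<^sup>2 - \<parallel>x \<epsilon>\<parallel>\<^sup>2\<close>. The first bound puts \<open>x \<epsilon>\<close> in the ball to which the truncated
  continuity applies, with \<open>y = - \<epsilon> x \<epsilon>\<close>, so some zero \<open>s\<close> lies within \<open>r = \<rho> (\<epsilon> a)\<close> of \<open>x \<epsilon>\<close>.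
  Since \<open>\<parallel>s\<parallel> \<ge> a\<close>, also \<open>\<parallel>x \<epsilon>\<parallel> \<ge> a - r\<close>, and the second bound then gives
  \<open>\<parallel>x \<epsilon> - xt\<parallel>\<^sup>2 \<le> r\<^sup>2 + 2 r a\<close>.

  The substantial point is the existence of \<open>x \<epsilon>\<close>, which is Minty's theorem in a Hilbert space.
  It is reduced to a minimization problem over a convex set \<open>K\<close> of pairs \<open>(p, s)\<close> in the product
  of the space with the reals. The function \<open>\<parallel>p\<parallel>\<^sup>2 + s\<close> is uniformly convex in \<open>p\<close> and affine in
  \<open>s\<close>, so along a minimizing sequence the \<open>p\<close>-components are Cauchy, even where the sequence in
  \<open>K\<close> does not converge; the limit \<open>z\<close> satisfies the variational inequality
  \<open>\<mu> + \<parallel>p - z\<parallel>\<^sup>2 \<le> \<parallel>p\<parallel>\<^sup>2 + s\<close> on all of \<open>K\<close> (lemma \<open>quadratic_minimizing_sequence\<close>).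
  For \<open>K = S \<times> {0}\<close> this yields the least-norm element of \<open>S\<close>. For Minty's theorem, with
  \<open>(u, v)\<close> ranging over a monotone graph, \<open>K\<close> is the convex hull of the pairs \<open>((u - v) / 2, \<langle>v, u\<rangle>)\<close>; monotonicity makes
  the infimum nonnegative, and the variational inequality becomes
  \<open>\<langle>z + v, z - u\<rangle> \<le> 0\<close>, which says that \<open>(z, - z)\<close> is monotonically related to the graph
  (lemma \<open>monotone_graph_extension\<close>).
\<close>

section \<open>Minimizing sequences\<close>

lemma norm_sq_interpolation:
  fixes p q :: "'a::real_inner"
  shows "(norm ((1 - t) *\<^sub>R p + t *\<^sub>R q))\<^sup>2
    = (1 - t) * (norm p)\<^sup>2 + t * (norm q)\<^sup>2 - t * (1 - t) * (norm (p - q))\<^sup>2"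
  by (simp add: power2_norm_eq_inner inner_add_left inner_add_right inner_diff_left
      inner_diff_right inner_commute[of q p] algebra_simps)

text \<open>
  With \<open>Q\<close> for the quadratic function, the interpolation identity gives
  \<open>\<mu> \<le> (1 - t) Q (q n) + t Q p - t (1 - t) \<parallel>fst (q n) - fst p\<parallel>\<^sup>2\<close> for each \<open>p \<in> K\<close>. The choice
  \<open>p = q m\<close>, \<open>t = 1 / 2\<close> shows that the sequence is Cauchy; letting first \<open>n \<rightarrow> \<infinity>\<close>, then dividing
  by \<open>t\<close> and letting \<open>t \<rightarrow> 0\<close> gives the variational inequality.
\<close>
lemma quadratic_minimizing_sequence:
  fixes K :: "('a::{real_inner, complete_space} \<times> real) set" and b :: real
  assumes "convex K" "K \<noteq> {}"
    and lower: "\<And>p s. (p, s) \<in> K \<Longrightarrow> b \<le> (norm p)\<^sup>2 + s"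
  obtains z \<mu> q where "\<And>n. q n \<in> K" "(\<lambda>n. fst (q n)) \<longlonglongrightarrow> z"
    "(\<lambda>n. (norm (fst (q n)))\<^sup>2 + snd (q n)) \<longlonglongrightarrow> \<mu>" "b \<le> \<mu>"
    "\<forall>(p, s)\<in>K. \<mu> + (norm (p - z))\<^sup>2 \<le> (norm p)\<^sup>2 + s"
proof -
  define Q :: "'a \<times> real \<Rightarrow> real" where "Q p = (norm (fst p))\<^sup>2 + snd p" for p
  define \<mu> where "\<mu> = Inf (Q ` K)"
  have lowerQ: "b \<le> Q p" if "p \<in> K" for p
    using lower[of "fst p" "snd p"] that by (simp add: Q_def)
  have bdd: "bdd_below (Q ` K)" using lowerQ by (auto intro!: bdd_belowI)
  have \<mu>_le: "\<mu> \<le> Q p" if "p \<in> K" for p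
    unfolding \<mu>_def using bdd that by (intro cInf_lower) auto
  have b_le: "b \<le> \<mu>" unfolding \<mu>_def using assms(2) lowerQ by (intro cInf_greatest) auto
  have interp: "\<mu> \<le> (1 - t) * Q p + t * Q q - t * (1 - t) * (norm (fst p - fst q))\<^sup>2"
    if "p \<in> K" "q \<in> K" "0 \<le> t" "t \<le> 1" for p q t
  proof -
    have "(1 - t) *\<^sub>R p + t *\<^sub>R q \<in> K" using assms(1) that by (intro convexD) auto
    then have "\<mu> \<le> Q ((1 - t) *\<^sub>R p + t *\<^sub>R q)" by (rule \<mu>_le)
    also have "\<dots> = (1 - t) * Q p + t * Q q - t * (1 - t) * (norm (fst p - fst q))\<^sup>2"
      unfolding Q_def fst_add snd_add fst_scaleR snd_scaleR norm_sq_interpolation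
      by (simp add: algebra_simps)
    finally show ?thesis .
  qed
  have "\<exists>p\<in>K. Q p < \<mu> + 1 / real (Suc n)" for n
    using cInf_lessD[of "Q ` K" "\<mu> + 1 / real (Suc n)"] assms(2) by (auto simp: \<mu>_def)
  then obtain q where qK: "\<And>n. q n \<in> K" and q_less: "\<And>n. Q (q n) < \<mu> + 1 / real (Suc n)"
    by metis
  have Q_lim: "(\<lambda>n. Q (q n)) \<longlonglongrightarrow> \<mu>"
  proof (rule tendsto_sandwich)
    show "\<forall>\<^sub>F n in sequentially. \<mu> \<le> Q (q n)" using qK \<mu>_le by auto
    show "\<forall>\<^sub>F n in sequentially. Q (q n) \<le> \<mu> + 1 / real (Suc n)"
      using q_less by (auto intro!: always_eventually less_imp_le)
    show "(\<lambda>n. \<mu> + 1 / real (Suc n)) \<longlonglongrightarrow> \<mu>"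
      using tendsto_add[OF tendsto_const LIMSEQ_inverse_real_of_nat, of \<mu>]
      by (simp add: inverse_eq_divide)
  qed simp
  have "Cauchy (\<lambda>n. fst (q n))"
  proof (rule metric_CauchyI)
    fix e :: real assume "0 < e"
    then obtain N where N: "1 / real (Suc N) < e\<^sup>2 / 4"
      using nat_approx_posE[of "e\<^sup>2 / 4"] by auto
    have "dist (fst (q m)) (fst (q n)) < e" if "N \<le> m" "N \<le> n" for m n
    proof -
      have small: "Q (q k) < \<mu> + e\<^sup>2 / 4" if "N \<le> k" for k
      proof -
        have "1 / real (Suc k) \<le> 1 / real (Suc N)" using that by (simp add: frac_le)
        then show ?thesis using q_less[of k] N by linarith
      qed
      have "\<mu> \<le> (1 / 2) * Q (q m) + (1 / 2) * Q (q n) - (1 / 4) * (norm (fst (q m) - fst (q n)))\<^sup>2"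
        using interp[OF qK qK, of "1 / 2" m n] by simp
      then have "(norm (fst (q m) - fst (q n)))\<^sup>2 < e\<^sup>2"
        using small[OF that(1)] small[OF that(2)] by linarith
      then show ?thesis using \<open>0 < e\<close> by (simp add: dist_norm power2_less_imp_less)
    qed
    then show "\<exists>N. \<forall>m\<ge>N. \<forall>n\<ge>N. dist (fst (q m)) (fst (q n)) < e" by blast
  qed
  then obtain z where z: "(\<lambda>n. fst (q n)) \<longlonglongrightarrow> z"
    using Cauchy_convergent_iff convergent_def by blast
  have vi: "\<mu> + (norm (fst p - z))\<^sup>2 \<le> Q p" if "p \<in> K" for p
  proof -
    have t_ineq: "\<mu> + (1 - t) * (norm (z - fst p))\<^sup>2 \<le> Q p" if "0 < t" "t \<le> 1" for t
    proof -
      have "\<mu> \<le> (1 - t) * \<mu> + t * Q p - t * (1 - t) * (norm (z - fst p))\<^sup>2"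
      proof (rule LIMSEQ_le_const)
        show "(\<lambda>n. (1 - t) * Q (q n) + t * Q p - t * (1 - t) * (norm (fst (q n) - fst p))\<^sup>2)
            \<longlonglongrightarrow> (1 - t) * \<mu> + t * Q p - t * (1 - t) * (norm (z - fst p))\<^sup>2"
          by (intro tendsto_intros z Q_lim)
        show "\<exists>N. \<forall>n\<ge>N. \<mu>
            \<le> (1 - t) * Q (q n) + t * Q p - t * (1 - t) * (norm (fst (q n) - fst p))\<^sup>2"
          using interp[OF qK \<open>p \<in> K\<close>] that by auto
      qed
      then have "t * (\<mu> + (1 - t) * (norm (z - fst p))\<^sup>2) \<le> t * Q p"
        by (simp add: algebra_simps)
      then show ?thesis using that by simp
    qed
    have "\<mu> + (1 - 0) * (norm (z - fst p))\<^sup>2 \<le> Q p"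
    proof (rule tendsto_upperbound)
      show "((\<lambda>t. \<mu> + (1 - t) * (norm (z - fst p))\<^sup>2)
          \<longlongrightarrow> \<mu> + (1 - 0) * (norm (z - fst p))\<^sup>2) (at_right 0)"
        by (intro tendsto_intros)
      show "\<forall>\<^sub>F t in at_right 0. \<mu> + (1 - t) * (norm (z - fst p))\<^sup>2 \<le> Q p"
        using t_ineq by (auto simp: eventually_at_right_field intro!: exI[of _ 1])
    qed simp
    then show ?thesis by (simp add: norm_minus_commute)
  qed
  show ?thesis
  proof (rule that[OF qK z _ b_le])
    show "(\<lambda>n. (norm (fst (q n)))\<^sup>2 + snd (q n)) \<longlonglongrightarrow> \<mu>" using Q_lim by (simp add: Q_def)
    show "\<forall>(p, s)\<in>K. \<mu> + (norm (p - z))\<^sup>2 \<le> (norm p)\<^sup>2 + s" using vi by (fastforce simp: Q_def)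
  qed
qed

lemma least_norm_point:
  fixes S :: "'a::{real_inner, complete_space} set"
  assumes "closed S" "convex S" "S \<noteq> {}"
  obtains z where "z \<in> S" "\<And>p. p \<in> S \<Longrightarrow> p \<noteq> z \<Longrightarrow> norm z < norm p"
proof -
  have "convex (S \<times> {0::real})" "S \<times> {0::real} \<noteq> {}" using assms by (auto intro: convex_Times)
  then obtain z \<mu> q where q: "\<And>n. q n \<in> S \<times> {0::real}" "(\<lambda>n. fst (q n)) \<longlonglongrightarrow> z"
    "(\<lambda>n. (norm (fst (q n)))\<^sup>2 + snd (q n)) \<longlonglongrightarrow> \<mu>"
    and vi: "\<forall>(p, s)\<in>S \<times> {0}. \<mu> + (norm (p - z))\<^sup>2 \<le> (norm p)\<^sup>2 + s"
    by (rule quadratic_minimizing_sequence[of _ 0]) auto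
  have q_mem: "fst (q n) \<in> S" "snd (q n) = 0" for n using q(1)[of n] by auto
  have "(\<lambda>n. (norm (fst (q n)))\<^sup>2) \<longlonglongrightarrow> (norm z)\<^sup>2" by (intro tendsto_intros q(2))
  moreover have "(\<lambda>n. (norm (fst (q n)))\<^sup>2) \<longlonglongrightarrow> \<mu>" using q(3) q_mem(2) by simp
  ultimately have "\<mu> = (norm z)\<^sup>2" using LIMSEQ_unique by blast
  have "norm z < norm p" if "p \<in> S" "p \<noteq> z" for p
  proof -
    have "\<mu> + (norm (p - z))\<^sup>2 \<le> (norm p)\<^sup>2" using vi that(1) by fastforce
    moreover have "0 < (norm (p - z))\<^sup>2" using that(2) by simp
    ultimately have "(norm z)\<^sup>2 < (norm p)\<^sup>2" using \<open>\<mu> = (norm z)\<^sup>2\<close> by linarith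
    then show ?thesis by (rule power_less_imp_less_base) simp
  qed
  moreover have "z \<in> S" using assms(1) q_mem(1) q(2) by (rule closed_sequentially)
  ultimately show ?thesis using that by blast
qed

lemma proj_zero_eqI:
  assumes "z \<in> S" "\<And>p. p \<in> S \<Longrightarrow> p \<noteq> z \<Longrightarrow> norm z < norm p"
  shows "proj S 0 = z"
  unfolding proj_def
proof (rule the_equality)
  show "z \<in> S \<and> (\<forall>y\<in>S. dist 0 z \<le> dist 0 y)" using assms by force
  show "w = z" if "w \<in> S \<and> (\<forall>y\<in>S. dist 0 w \<le> dist 0 y)" for w
    using assms(1) assms(2)[of w] that by force
qed

section \<open>Minty's theorem\<close>

text \<open>
  The difficulty is that \<open>s - \<langle>v, u\<rangle>\<close> is not a convex function of \<open>(u, v, s)\<close>. It is half the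
  diagonal value of the form \<open>s + s' - \<langle>v, u'\<rangle> - \<langle>v', u\<rangle>\<close>, which is affine in each triple separately; on two
  triples that come from the graph this form equals \<open>\<langle>v - v', u - u'\<rangle>\<close>. Nonnegativity thus
  passes to the hull in one triple at a time.
\<close>
lemma convex_hull_monotone_graph:
  fixes G :: "('a::real_inner \<times> 'a) set"
  assumes mono: "\<And>u v u' v'. (u, v) \<in> G \<Longrightarrow> (u', v') \<in> G \<Longrightarrow> 0 \<le> inner (v - v') (u - u')"
    and mem: "(u, v, s) \<in> convex hull ((\<lambda>(u, v). (u, v, inner v u)) ` G)"
  shows "inner v u \<le> s"
proof -
  define T where "T = (\<lambda>(u, v). (u, v, inner v u)) ` G"
  define halfspace :: "'a \<times> 'a \<times> real \<Rightarrow> ('a \<times> 'a \<times> real) set"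
    where "halfspace q = (case q of (u', v', s') \<Rightarrow> {p. inner (v', u', - 1) p \<le> s'})" for q
  have halfspace_iff: "(u, v, s) \<in> halfspace (u', v', s')
      \<longleftrightarrow> 0 \<le> s + s' - inner v u' - inner v' u" for u v s u' v' s'
    by (auto simp: halfspace_def inner_commute[of v u'])
  have halfspace_sym: "p \<in> halfspace q \<longleftrightarrow> q \<in> halfspace p" for p q
    by (cases p; cases q) (auto simp: halfspace_iff)
  have convex: "convex (halfspace q)" for q
    by (auto simp: halfspace_def convex_halfspace_le split: prod.splits)
  have "T \<subseteq> halfspace q" if "q \<in> T" for q
    using that mono by (fastforce simp: T_def halfspace_iff inner_diff_left inner_diff_right)
  then have "convex hull T \<subseteq> halfspace q" if "q \<in> T" for q
    using that convex by (simp add: hull_minimal)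
  then have "T \<subseteq> halfspace p" if "p \<in> convex hull T" for p
    using that halfspace_sym by blast
  then have "convex hull T \<subseteq> halfspace p" if "p \<in> convex hull T" for p
    using that convex by (simp add: hull_minimal)
  then have "(u, v, s) \<in> halfspace (u, v, s)" using mem unfolding T_def by blast
  then show ?thesis by (simp add: halfspace_iff)
qed

text \<open>
  The lower bound needed for the minimization is
  \<open>\<parallel>(u - v) / 2\<parallel>\<^sup>2 + s \<ge> \<parallel>(u - v) / 2\<parallel>\<^sup>2 + \<langle>v, u\<rangle> = \<parallel>(u + v) / 2\<parallel>\<^sup>2 \<ge> 0\<close>,
  with the preceding lemma for the first step.
\<close>
lemma monotone_graph_extension:
  fixes G :: "('a::{real_inner, complete_space} \<times> 'a) set"
  assumes mono: "\<And>u v u' v'. (u, v) \<in> G \<Longrightarrow> (u', v') \<in> G \<Longrightarrow> 0 \<le> inner (v - v') (u - u')"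
  shows "\<exists>z. \<forall>(u, v)\<in>G. inner (z + v) (z - u) \<le> 0"
proof (cases "G = {}")
  case True
  then show ?thesis by simp
next
  case False
  define T where "T = (\<lambda>(u, v). (u, v, inner v u)) ` G"
  define f :: "'a \<times> 'a \<times> real \<Rightarrow> 'a \<times> real"
    where "f p = ((1 / 2) *\<^sub>R (fst p - fst (snd p)), snd (snd p))" for p
  have "linear f"
    by (rule linearI) (simp_all add: f_def prod_eq_iff algebra_simps)
  then have "convex (f ` (convex hull T))" by (intro convex_linear_image) auto
  moreover have "f ` (convex hull T) \<noteq> {}" using False by (simp add: T_def)
  moreover have "0 \<le> (norm p)\<^sup>2 + s" if ps: "(p, s) \<in> f ` (convex hull T)" for p s
  proof -
    obtain u v where uv: "(u, v, s) \<in> convex hull T" "p = (1 / 2) *\<^sub>R (u - v)"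
      using ps by (auto simp: f_def)
    have "(norm p)\<^sup>2 + inner v u = (norm ((1 / 2) *\<^sub>R (u + v)))\<^sup>2"
      unfolding uv(2) by (simp add: power2_norm_eq_inner inner_add_left inner_add_right
          inner_diff_left inner_diff_right inner_commute[of u v] field_simps)
    then have "0 \<le> (norm p)\<^sup>2 + inner v u" by simp
    then show ?thesis
      using convex_hull_monotone_graph[OF mono, of G u v s] uv(1) unfolding T_def by force
  qed
  ultimately obtain z \<mu> q where "0 \<le> \<mu>"
    and vi: "\<forall>(p, s)\<in>f ` (convex hull T). \<mu> + (norm (p - z))\<^sup>2 \<le> (norm p)\<^sup>2 + s"
    by (rule quadratic_minimizing_sequence[of _ 0]) blast
  have "inner (z + v) (z - u) \<le> 0" if "(u, v) \<in> G" for u v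
  proof -
    define p where "p = (1 / 2) *\<^sub>R (u - v)"
    have "(u, v, inner v u) \<in> convex hull T"
      using that by (intro hull_inc) (force simp: T_def)
    then have "(p, inner v u) \<in> f ` (convex hull T)" by (force simp: f_def p_def)
    with vi \<open>0 \<le> \<mu>\<close> have "(norm (p - z))\<^sup>2 \<le> (norm p)\<^sup>2 + inner v u"
      by fastforce
    moreover have "inner (z + v) (z - u) = (norm (p - z))\<^sup>2 - (norm p)\<^sup>2 - inner v u"
      by (simp add: p_def power2_norm_eq_inner inner_add_left inner_add_right inner_diff_left
          inner_diff_right inner_commute field_simps)
    ultimately show ?thesis by linarith
  qed
  then show ?thesis by blast
qed

text \<open>
  Otherwise, adding \<open>(z, w)\<close> to the graph would give a strictly larger monotone one.
\<close>
lemma maximal_monotone_memI: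
  assumes "maximal_monotone A"
    and rel: "\<And>u v. v \<in> A u \<Longrightarrow> 0 \<le> inner (v - w) (u - z)"
  shows "w \<in> A z"
proof (rule ccontr)
  assume "w \<notin> A z"
  define B where "B = A(z := insert w (A z))"
  have B: "y \<in> B x \<longleftrightarrow> y \<in> A x \<or> x = z \<and> y = w" for x y by (auto simp: B_def)
  have rel': "0 \<le> inner (w - v) (z - u)" if "v \<in> A u" for u v
    using rel[OF that] by (metis inner_minus_left inner_minus_right minus_diff_eq minus_minus)
  have "monotone_operator B"
    using assms(1) rel rel' unfolding maximal_monotone_def monotone_operator_def Ball_def B
    by auto
  moreover have "sv_graph A \<subset> sv_graph B"
  proof
    show "sv_graph A \<subseteq> sv_graph B" using B by (auto simp: sv_graph_def)
    have "(z, w) \<in> sv_graph B - sv_graph A" using \<open>w \<notin> A z\<close> B by (simp add: sv_graph_def)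
    then show "sv_graph A \<noteq> sv_graph B" by blast
  qed
  ultimately show False using assms(1) by (auto simp: maximal_monotone_def)
qed

lemma maximal_monotone_memD:
  assumes "maximal_monotone A" "v \<in> A u" "w \<in> A z"
  shows "0 \<le> inner (v - w) (u - z)"
  using assms by (auto simp: maximal_monotone_def monotone_operator_def)

lemma zero_in_add_scaled_id_iff: "0 \<in> add_scaled_id A \<epsilon> z \<longleftrightarrow> - (\<epsilon> *\<^sub>R z) \<in> A z"
proof -
  have "0 \<in> add_scaled_id A \<epsilon> z \<longleftrightarrow> (\<exists>y\<in>A z. 0 = y + \<epsilon> *\<^sub>R z)"
    by (simp add: add_scaled_id_def set_plus_def)
  also have "\<dots> \<longleftrightarrow> - (\<epsilon> *\<^sub>R z) \<in> A z" by (metis add.inverse_unique add.commute add.right_inverse)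
  finally show ?thesis .
qed

text \<open>
  The graph of \<open>A / \<epsilon>\<close> is monotone, so some \<open>(z, - z)\<close> is monotonically related to it; equivalently,
  \<open>(z, - \<epsilon> z)\<close> is monotonically related to the graph of \<open>A\<close>, and belongs to it by maximality.
  Two solutions coincide because \<open>- \<epsilon> Id\<close> is strictly decreasing, against the monotonicity of \<open>A\<close>.
\<close>
lemma tikhonov_equation_unique_solution:
  fixes A :: "'a::{real_inner, complete_space} svmap"
  assumes "maximal_monotone A" "0 < \<epsilon>"
  shows "\<exists>!z. 0 \<in> add_scaled_id A \<epsilon> z"
  unfolding zero_in_add_scaled_id_iff
proof (rule ex_ex1I)
  define G where "G = {(u, v). \<epsilon> *\<^sub>R v \<in> A u}"
  have "0 \<le> inner (v - v') (u - u')" if "(u, v) \<in> G" "(u', v') \<in> G" for u v u' v'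
  proof -
    have "0 \<le> inner (\<epsilon> *\<^sub>R v - \<epsilon> *\<^sub>R v') (u - u')"
      using that by (intro maximal_monotone_memD[OF assms(1)]) (auto simp: G_def)
    also have "\<dots> = \<epsilon> * inner (v - v') (u - u')"
      by (metis scaleR_diff_right inner_scaleR_left)
    finally show ?thesis using assms(2) by (simp add: zero_le_mult_iff)
  qed
  then have "\<exists>z. \<forall>(u, v)\<in>G. inner (z + v) (z - u) \<le> 0" by (rule monotone_graph_extension)
  then obtain z where z: "\<forall>(u, v)\<in>G. inner (z + v) (z - u) \<le> 0" ..
  have "- (\<epsilon> *\<^sub>R z) \<in> A z"
  proof (rule maximal_monotone_memI[OF assms(1)])
    fix u v assume "v \<in> A u"
    then have "(u, (1 / \<epsilon>) *\<^sub>R v) \<in> G" using assms(2) by (simp add: G_def)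
    with z have "inner (z + (1 / \<epsilon>) *\<^sub>R v) (z - u) \<le> 0" by fast
    then have "\<epsilon> * inner (z + (1 / \<epsilon>) *\<^sub>R v) (z - u) \<le> 0"
      using assms(2) by (simp add: mult_le_0_iff)
    moreover have "\<epsilon> * inner (z + (1 / \<epsilon>) *\<^sub>R v) (z - u) = - inner (v - - (\<epsilon> *\<^sub>R z)) (u - z)"
      using assms(2) by (simp add: inner_add_left inner_diff_right algebra_simps)
    ultimately show "0 \<le> inner (v - - (\<epsilon> *\<^sub>R z)) (u - z)" by linarith
  qed
  then show "\<exists>z. - (\<epsilon> *\<^sub>R z) \<in> A z" ..
next
  fix z w assume "- (\<epsilon> *\<^sub>R z) \<in> A z" "- (\<epsilon> *\<^sub>R w) \<in> A w"
  from maximal_monotone_memD[OF assms(1) this]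
  have "\<epsilon> * (norm (z - w))\<^sup>2 \<le> 0"
    by (simp add: power2_norm_eq_inner inner_diff_left inner_diff_right algebra_simps)
  then show "z = w" using assms(2) by (simp add: mult_le_0_iff)
qed

lemma tikhonov_point_mem:
  fixes A :: "'a::{real_inner, complete_space} svmap"
  assumes "maximal_monotone A" "0 < \<epsilon>"
  shows "0 \<in> add_scaled_id A \<epsilon> (tikhonov_point A \<epsilon>)"
proof -
  obtain z where z: "sv_inverse (add_scaled_id A \<epsilon>) 0 = {z}"
    using tikhonov_equation_unique_solution[OF assms] by (auto simp: sv_inverse_def)
  then show ?thesis by (auto simp: tikhonov_point_def sv_inverse_def)
qed

section \<open>The set of zeros\<close>

text \<open>
  By maximality the zeros are the points \<open>z\<close> that satisfy all the affine inequalities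
  \<open>\<langle>v, u - z\<rangle> \<ge> 0\<close> with \<open>(u, v)\<close> in the graph.
\<close>
lemma zeros_closed_convex:
  fixes A :: "'a::real_inner svmap"
  assumes "maximal_monotone A"
  shows "closed (sv_inverse A 0)" "convex (sv_inverse A 0)"
proof -
  have eq: "sv_inverse A 0 = (\<Inter>(u, v)\<in>sv_graph A. {z. inner v z \<le> inner v u})"
    using maximal_monotone_memI[OF assms, of 0] maximal_monotone_memD[OF assms, of _ _ 0]
    by (fastforce simp: sv_inverse_def sv_graph_def inner_diff_right)
  show "closed (sv_inverse A 0)" "convex (sv_inverse A 0)"
    unfolding eq by (auto intro!: closed_INT convex_INT closed_halfspace_le convex_halfspace_le)
qed

section \<open>Estimates for the regularized solutions\<close>

lemma regularized_solution_inner_le: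
  fixes A :: "'a::real_inner svmap"
  assumes "maximal_monotone A" "0 < \<epsilon>" "- (\<epsilon> *\<^sub>R z) \<in> A z" "0 \<in> A w"
  shows "(norm z)\<^sup>2 \<le> inner z w"
proof -
  have "\<epsilon> * ((norm z)\<^sup>2 - inner z w) \<le> 0"
    using maximal_monotone_memD[OF assms(1,3,4)]
    by (simp add: power2_norm_eq_inner inner_diff_right algebra_simps)
  then show ?thesis using assms(2) by (simp add: mult_le_0_iff)
qed

lemma regularized_solution_norm_le:
  fixes A :: "'a::real_inner svmap"
  assumes "maximal_monotone A" "0 < \<epsilon>" "- (\<epsilon> *\<^sub>R z) \<in> A z" "0 \<in> A w"
  shows "norm z \<le> norm w"
proof -
  have "norm z * norm z \<le> norm z * norm w"
    using regularized_solution_inner_le[OF assms] norm_cauchy_schwarz[of z w]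
    by (simp add: power2_eq_square)
  then show ?thesis by (cases "norm z = 0") auto
qed

lemma regularized_solution_dist_le:
  fixes A :: "'a::real_inner svmap"
  assumes "maximal_monotone A" "0 < \<epsilon>" "- (\<epsilon> *\<^sub>R z) \<in> A z" "0 \<in> A w"
  shows "(norm (z - w))\<^sup>2 \<le> (norm w)\<^sup>2 - (norm z)\<^sup>2"
  using regularized_solution_inner_le[OF assms]
  by (simp add: power2_norm_eq_inner inner_diff_left inner_diff_right inner_commute)

text \<open>
  Monotonicity and the Cauchy-Schwarz inequality give \<open>(p - q) (\<epsilon> p - \<delta> q) \<le> 0\<close> for
  \<open>p = \<parallel>z\<parallel>\<close> and \<open>q = \<parallel>w\<parallel>\<close>. If \<open>q > p\<close>, then \<open>\<delta> q \<le> \<epsilon> p \<le> \<epsilon> q\<close>, which contradicts \<open>\<epsilon> < \<delta>\<close>.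
\<close>
lemma regularized_solution_norm_antimono:
  fixes A :: "'a::real_inner svmap"
  assumes "maximal_monotone A" "0 < \<epsilon>" "\<epsilon> < \<delta>" "- (\<epsilon> *\<^sub>R z) \<in> A z" "- (\<delta> *\<^sub>R w) \<in> A w"
  shows "norm w \<le> norm z"
proof (rule ccontr)
  assume "\<not> norm w \<le> norm z"
  then have less: "norm z < norm w" by simp
  have "\<epsilon> * (norm z)\<^sup>2 + \<delta> * (norm w)\<^sup>2 \<le> (\<epsilon> + \<delta>) * inner z w"
    using maximal_monotone_memD[OF assms(1,4,5)]
    by (simp add: power2_norm_eq_inner inner_diff_left inner_diff_right inner_commute
        algebra_simps)
  also have "\<dots> \<le> (\<epsilon> + \<delta>) * (norm z * norm w)"
    using norm_cauchy_schwarz[of z w] assms(2,3) by (intro mult_left_mono) auto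
  finally have "(norm w - norm z) * (\<delta> * norm w - \<epsilon> * norm z) \<le> 0"
    by (simp add: power2_eq_square algebra_simps)
  then have "\<delta> * norm w \<le> \<epsilon> * norm z" using less by (simp add: mult_le_0_iff)
  also have "\<dots> \<le> \<epsilon> * norm w" using less assms(2) by simp
  also have "\<dots> < \<delta> * norm w"
    using less assms(3) norm_ge_zero[of z] by (intro mult_strict_right_mono) linarith+
  finally show False by simp
qed

text \<open>
  The continuity is used at \<open>y = - \<epsilon> z\<close>, and \<open>\<parallel>y\<parallel> \<le> \<epsilon> a\<close>: hence the bound by \<open>\<rho> (\<epsilon> a)\<close>, which no
  longer involves \<open>z\<close>.
\<close>
lemma truncately_R_continuous_near_zero:
  fixes A :: "'a::real_inner svmap"
  assumes "truncately_R_continuous_at_0 (sv_inverse A) a \<rho> \<sigma>"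
    and "0 \<le> \<epsilon>" "\<epsilon> * a \<le> \<sigma>" "- (\<epsilon> *\<^sub>R z) \<in> A z" "norm z \<le> a"
  obtains s where "s \<in> sv_inverse A 0" "dist z s \<le> \<rho> (\<epsilon> * a)"
proof -
  have \<rho>_mono: "mono_on {0..} \<rho>"
    and cont: "\<And>y. norm y \<le> \<sigma> \<Longrightarrow>
      sv_inverse A y \<inter> cball 0 a \<subseteq> sv_inverse A 0 + cball 0 (\<rho> (norm y))"
    using assms(1) by (auto simp: truncately_R_continuous_at_0_def modulus_function_def)
  have norm_le: "\<epsilon> * norm z \<le> \<epsilon> * a" using assms(2,5) by (simp add: mult_left_mono)
  have "z \<in> sv_inverse A (- (\<epsilon> *\<^sub>R z)) \<inter> cball 0 a" using assms(4,5) by (simp add: sv_inverse_def)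
  then have "z \<in> sv_inverse A 0 + cball 0 (\<rho> (\<epsilon> * norm z))"
    using cont[of "- (\<epsilon> *\<^sub>R z)"] norm_le assms(2,3) by auto
  then obtain s b where s: "s \<in> sv_inverse A 0" "norm b \<le> \<rho> (\<epsilon> * norm z)" "z = s + b"
    by (auto elim: set_plus_elim)
  have "\<rho> (\<epsilon> * norm z) \<le> \<rho> (\<epsilon> * a)"
  proof (rule mono_onD[OF \<rho>_mono _ _ norm_le])
    show "\<epsilon> * norm z \<in> {0..}" using assms(2) by simp
    then show "\<epsilon> * a \<in> {0..}" using norm_le by simp
  qed
  then show ?thesis using that[of s] s by (simp add: dist_norm)
qed

theorem theorem1:
  fixes A :: "'a::{real_inner, complete_space} \<Rightarrow> 'a set"
    and S :: "'a set" and xt :: 'a and a \<sigma> :: real and \<rho> :: "real \<Rightarrow> real"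
    and x :: "real \<Rightarrow> 'a"
  assumes "maximal_monotone A"
    and "0 \<in> sv_range A"
    and "S = sv_inverse A 0"
    and "xt = proj S 0"
    and "a = norm xt"
    and "truncately_R_continuous_at_0 (sv_inverse A) a \<rho> \<sigma>"
    and "\<And>\<epsilon>. x \<epsilon> = tikhonov_point A \<epsilon>"
  shows "S \<noteq> {} \<and> closed S \<and> convex S
    \<and> xt \<in> S \<and> (\<forall>s\<in>S. s \<noteq> xt \<longrightarrow> norm xt < norm s)
    \<and> (\<forall>\<epsilon>>0. (\<exists>!z. 0 \<in> add_scaled_id A \<epsilon> z) \<and> 0 \<in> add_scaled_id A \<epsilon> (x \<epsilon>))
    \<and> (\<forall>\<epsilon>>0. \<epsilon> * a \<le> \<sigma> \<longrightarrow>
          norm (x \<epsilon>) \<le> norm xt \<and> infdist (x \<epsilon>) S \<le> \<rho> (\<epsilon> * a))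
    \<and> (\<forall>\<epsilon> \<delta>. 0 < \<epsilon> \<and> \<epsilon> < \<delta> \<and> \<delta> * a \<le> \<sigma> \<longrightarrow> norm (x \<delta>) \<le> norm (x \<epsilon>))
    \<and> (x \<longlongrightarrow> xt) (at_right 0)
    \<and> (\<forall>\<epsilon>>0. \<epsilon> * a \<le> \<sigma> \<longrightarrow>
          norm (x \<epsilon> - xt) \<le> \<rho> (\<epsilon> * a) + sqrt ((\<rho> (\<epsilon> * a))\<^sup>2 + 2 * \<rho> (\<epsilon> * a) * a))"
proof -
  note max = assms(1)
  have \<rho>: "\<sigma> > 0" "\<And>r. 0 \<le> r \<Longrightarrow> 0 \<le> \<rho> r" "(\<rho> \<longlongrightarrow> 0) (at_right 0)" "\<rho> 0 = 0"
    using assms(6) by (auto simp: truncately_R_continuous_at_0_def modulus_function_def)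
  have S_iff: "s \<in> S \<longleftrightarrow> 0 \<in> A s" for s by (simp add: assms(3) sv_inverse_def)
  have S: "S \<noteq> {}" "closed S" "convex S"
    using assms(2) zeros_closed_convex[OF max] by (auto simp: assms(3) sv_range_def sv_inverse_def)
  obtain z where "z \<in> S" "\<And>s. s \<in> S \<Longrightarrow> s \<noteq> z \<Longrightarrow> norm z < norm s"
    using least_norm_point[OF S(2,3,1)] by blast
  with proj_zero_eqI[of z S]
  have xt: "xt \<in> S" "\<And>s. s \<in> S \<Longrightarrow> s \<noteq> xt \<Longrightarrow> norm xt < norm s" by (auto simp: assms(4))
  have a_le: "a \<le> norm s" if "s \<in> S" for s
    using xt(2)[OF that] by (cases "s = xt") (auto simp: assms(5))
  have "0 \<le> a" by (simp add: assms(5))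
  have x_mem: "0 \<in> add_scaled_id A \<epsilon> (x \<epsilon>)" if "0 < \<epsilon>" for \<epsilon>
    unfolding assms(7) using tikhonov_point_mem[OF max that] .
  then have x_eq: "- (\<epsilon> *\<^sub>R x \<epsilon>) \<in> A (x \<epsilon>)" if "0 < \<epsilon>" for \<epsilon>
    using that by (simp add: zero_in_add_scaled_id_iff)
  have x_le: "norm (x \<epsilon>) \<le> a" if "0 < \<epsilon>" for \<epsilon>
    using regularized_solution_norm_le[OF max that x_eq[OF that]] xt(1)
    by (simp add: S_iff assms(5))
  have near: "\<exists>s\<in>S. dist (x \<epsilon>) s \<le> \<rho> (\<epsilon> * a)" if "0 < \<epsilon>" "\<epsilon> * a \<le> \<sigma>" for \<epsilon>
    using truncately_R_continuous_near_zero[OF assms(6) _ that(2) x_eq[OF that(1)] x_le[OF that(1)]]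
      that(1) unfolding assms(3) by (metis less_imp_le)
  have infdist_le: "infdist (x \<epsilon>) S \<le> \<rho> (\<epsilon> * a)" if "0 < \<epsilon>" "\<epsilon> * a \<le> \<sigma>" for \<epsilon>
    using near[OF that] infdist_le2 by blast
  have rate: "norm (x \<epsilon> - xt) \<le> \<rho> (\<epsilon> * a) + sqrt ((\<rho> (\<epsilon> * a))\<^sup>2 + 2 * \<rho> (\<epsilon> * a) * a)"
    if \<epsilon>: "0 < \<epsilon>" "\<epsilon> * a \<le> \<sigma>" for \<epsilon>
  proof -
    define r where "r = \<rho> (\<epsilon> * a)"
    have "0 \<le> r" using \<rho>(2) \<epsilon>(1) \<open>0 \<le> a\<close> by (simp add: r_def)
    obtain s where s: "s \<in> S" "dist (x \<epsilon>) s \<le> r" using near[OF \<epsilon>] by (auto simp: r_def)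
    have "a - r \<le> norm (x \<epsilon>)"
      using a_le[OF s(1)] s(2) norm_triangle_ineq2[of s "x \<epsilon>"]
      by (simp add: dist_norm norm_minus_commute)
    (* The lower bound can be squared only if it is nonnegative; otherwise a < r, and the
       right-hand side already exceeds a^2. *)
    then have "a\<^sup>2 - (norm (x \<epsilon>))\<^sup>2 \<le> r\<^sup>2 + 2 * r * a"
    proof (cases "r \<le> a")
      case True
      then have "(a - r)\<^sup>2 \<le> (norm (x \<epsilon>))\<^sup>2" using \<open>a - r \<le> norm (x \<epsilon>)\<close> by (intro power_mono) auto
      then have "a\<^sup>2 - (norm (x \<epsilon>))\<^sup>2 \<le> 2 * r * a - r\<^sup>2" by (simp add: power2_diff algebra_simps)
      then show ?thesis using zero_le_power2[of r] by linarith
    next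
      case False
      then have "a\<^sup>2 \<le> r\<^sup>2" using \<open>0 \<le> a\<close> by (intro power_mono) auto
      moreover have "0 \<le> 2 * r * a" using \<open>0 \<le> a\<close> \<open>0 \<le> r\<close> by simp
      ultimately show ?thesis using zero_le_power2[of "norm (x \<epsilon>)"] by linarith
    qed
    then have "(norm (x \<epsilon> - xt))\<^sup>2 \<le> r\<^sup>2 + 2 * r * a"
      using regularized_solution_dist_le[OF max \<epsilon>(1) x_eq[OF \<epsilon>(1)], of xt] xt(1)
      by (simp add: S_iff assms(5))
    then have "norm (x \<epsilon> - xt) \<le> sqrt (r\<^sup>2 + 2 * r * a)" by (rule real_le_rsqrt)
    then show ?thesis using \<open>0 \<le> r\<close> by (simp add: r_def)
  qed
  have \<rho>_lim: "((\<lambda>\<epsilon>. \<rho> (\<epsilon> * a)) \<longlongrightarrow> 0) (at_right 0)"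
  proof (cases "a = 0")
    case True
    then show ?thesis using \<rho>(4) by simp
  next
    case False
    then have "0 < a" using \<open>0 \<le> a\<close> by simp
    have "filterlim (\<lambda>\<epsilon>. \<epsilon> * a) (at_right 0) (at_right 0)"
      unfolding filterlim_at
    proof
      show "\<forall>\<^sub>F \<epsilon> in at_right 0. \<epsilon> * a \<in> {0<..} \<and> \<epsilon> * a \<noteq> 0"
        using \<open>0 < a\<close> by (auto simp: eventually_at_right_field intro!: exI[of _ 1])
      show "((\<lambda>\<epsilon>. \<epsilon> * a) \<longlongrightarrow> 0) (at_right 0)"
        by (rule tendsto_eq_intros refl | simp)+
    qed
    with \<rho>(3) show ?thesis by (rule filterlim_compose)
  qed
  have small: "\<forall>\<^sub>F \<epsilon> in at_right 0. 0 < \<epsilon> \<and> \<epsilon> * a \<le> \<sigma>"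
  proof -
    have "\<epsilon> * a \<le> \<sigma>" if "0 < \<epsilon>" "\<epsilon> < \<sigma> / (a + 1)" for \<epsilon>
    proof -
      have "\<epsilon> * (a + 1) < \<sigma>" using that(2) \<open>0 \<le> a\<close> by (simp add: less_divide_eq)
      then show ?thesis using that(1) by (simp add: algebra_simps)
    qed
    then show ?thesis using \<rho>(1) \<open>0 \<le> a\<close>
      by (auto simp: eventually_at_right_field intro!: exI[of _ "\<sigma> / (a + 1)"])
  qed
  have "((\<lambda>\<epsilon>. x \<epsilon> - xt) \<longlongrightarrow> 0) (at_right 0)"
  proof (rule Lim_null_comparison)
    show "\<forall>\<^sub>F \<epsilon> in at_right 0. norm (x \<epsilon> - xt)
        \<le> \<rho> (\<epsilon> * a) + sqrt ((\<rho> (\<epsilon> * a))\<^sup>2 + 2 * \<rho> (\<epsilon> * a) * a)"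
      using small by eventually_elim (use rate in blast)
    show "((\<lambda>\<epsilon>. \<rho> (\<epsilon> * a) + sqrt ((\<rho> (\<epsilon> * a))\<^sup>2 + 2 * \<rho> (\<epsilon> * a) * a)) \<longlongrightarrow> 0) (at_right 0)"
      by (rule tendsto_eq_intros \<rho>_lim refl | simp)+
  qed
  then have lim: "(x \<longlongrightarrow> xt) (at_right 0)" by (rule LIM_zero_cancel)
  have antimono: "norm (x \<delta>) \<le> norm (x \<epsilon>)" if "0 < \<epsilon>" "\<epsilon> < \<delta>" for \<epsilon> \<delta>
    using regularized_solution_norm_antimono[OF max that x_eq x_eq] that by auto
  show ?thesis
    using S xt tikhonov_equation_unique_solution[OF max] x_mem x_le infdist_le antimono lim rate
    by (auto simp: assms(5))
qed

end
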